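(* Let $F$ be a field. If an $F$-algebra $A$ is two-sided zero product determined, then $A$ is zero product determined and zero Lie product determined.
   Context: $F$ is an arbitrary field; an algebra means an associative $F$-algebra with unity $1$. For $x,y\in A$, $[x,y]=xy-yx$. An algebra $A$ is two-sided zero product determined (2-zpd) if every bilinear functional $\varphi:A\times A\to F$ with the property that for all $x,y\in A$, $xy=yx=0$ implies $\varphi(x,y)=0$, is of the form $\varphi(x,y)=\tau_1(xy)+\tau_2(yx)$ (for all $x,y\in A$) for some linear functionals $\tau_1,\tau_2$ on $A$. An algebra $A$ is zero product determined (zpd) if every bilinear functional $\varphi:A\times A\to F$ with the property that for all $x,y\in A$, $xy=0$ implies $\varphi(x,y)=0$, is of the form $\varphi(x,y)=\tau(xy)$ (for all $x,y\in A$) for some linear functional $\tau$. An algebra $A$ is zero Lie product determined (zLpd) if every bilinear functional $\varphi:A\times A\to F$ with the property that for all $x,y\in A$, $[x,y]=0$ implies $\varphi(x,y)=0$, is of the form $\varphi(x,y)=\tau([x,y])$ (for all $x,y\in A$) for some linear functional $\tau$. *)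

theory Defs
  imports Main "HOL.Vector_Spaces"
begin

(* The sort {ring, monoid_mult} is that of associative rings with unity; unlike ring_1 it does
   not impose 0 \<noteq> 1, so the zero algebra is included. *)
locale unital_algebra = vector_space scale
  for scale :: "'f::field \<Rightarrow> 'a::{ring, monoid_mult} \<Rightarrow> 'a" +
  assumes scale_mult_left: "scale c x * y = scale c (x * y)"
    and scale_mult_right: "x * scale c y = scale c (x * y)"

definition lie_bracket :: "'a::ring \<Rightarrow> 'a \<Rightarrow> 'a" where
  "lie_bracket x y = x * y - y * x"

abbreviation linear_functional :: "('f::field \<Rightarrow> 'a::ab_group_add \<Rightarrow> 'a) \<Rightarrow> ('a \<Rightarrow> 'f) \<Rightarrow> bool" where
  "linear_functional scale \<tau> \<equiv> Vector_Spaces.linear scale (*) \<tau>"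

definition bilinear_functional ::
    "('f::field \<Rightarrow> 'a::ab_group_add \<Rightarrow> 'a) \<Rightarrow> ('a \<Rightarrow> 'a \<Rightarrow> 'f) \<Rightarrow> bool" where
  "bilinear_functional scale \<phi> \<longleftrightarrow>
     (\<forall>x. linear_functional scale (\<lambda>y. \<phi> x y)) \<and>
     (\<forall>y. linear_functional scale (\<lambda>x. \<phi> x y))"

definition two_sided_zero_product_determined ::
    "('f::field \<Rightarrow> 'a::{ring, monoid_mult} \<Rightarrow> 'a) \<Rightarrow> bool" where
  "two_sided_zero_product_determined scale \<longleftrightarrow>
     (\<forall>\<phi>. bilinear_functional scale \<phi> \<and>
          (\<forall>x y. x * y = 0 \<and> y * x = 0 \<longrightarrow> \<phi> x y = 0) \<longrightarrow>
          (\<exists>\<tau>\<^sub>1 \<tau>\<^sub>2. linear_functional scale \<tau>\<^sub>1 \<and> linear_functional scale \<tau>\<^sub>2 \<and>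
             (\<forall>x y. \<phi> x y = \<tau>\<^sub>1 (x * y) + \<tau>\<^sub>2 (y * x))))"

definition zero_product_determined ::
    "('f::field \<Rightarrow> 'a::{ring, monoid_mult} \<Rightarrow> 'a) \<Rightarrow> bool" where
  "zero_product_determined scale \<longleftrightarrow>
     (\<forall>\<phi>. bilinear_functional scale \<phi> \<and>
          (\<forall>x y. x * y = 0 \<longrightarrow> \<phi> x y = 0) \<longrightarrow>
          (\<exists>\<tau>. linear_functional scale \<tau> \<and> (\<forall>x y. \<phi> x y = \<tau> (x * y))))"

definition zero_lie_product_determined ::
    "('f::field \<Rightarrow> 'a::{ring, monoid_mult} \<Rightarrow> 'a) \<Rightarrow> bool" where
  "zero_lie_product_determined scale \<longleftrightarrow>
     (\<forall>\<phi>. bilinear_functional scale \<phi> \<and>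
          (\<forall>x y. lie_bracket x y = 0 \<longrightarrow> \<phi> x y = 0) \<longrightarrow>
          (\<exists>\<tau>. linear_functional scale \<tau> \<and> (\<forall>x y. \<phi> x y = \<tau> (lie_bracket x y))))"

end

(* If xy = 0 forces \<phi>(x, y) = 0, then it also forces \<phi>(x, yz) = 0 for each fixed z, so
   \<phi>(x, yz) = \<tau>\<^sub>1(xy) + \<tau>\<^sub>2(yx). This expression takes the same value at (x, 1) and at (1, x), whence
   \<phi>(x, z) = \<phi>(1, xz). If instead \<phi> vanishes on commuting pairs, then
   \<phi>(x, y) = \<tau>\<^sub>1(xy) + \<tau>\<^sub>2(yx), and 0 = \<phi>(x, 1) gives \<tau>\<^sub>2 = -\<tau>\<^sub>1. *)
theory Submission
  imports Defs
begin

text \<open>Both sides equal \<open>\<tau>\<^sub>1 x + \<tau>\<^sub>2 x\<close>, because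
  \<open>1\<close> commutes with \<open>x\<close>.\<close>

lemma two_sided_zpd_exchange_unit:
  assumes "two_sided_zero_product_determined scale"
    and "bilinear_functional scale \<phi>"
    and "\<And>x y. x * y = 0 \<Longrightarrow> y * x = 0 \<Longrightarrow> \<phi> x y = 0"
  shows "\<phi> x 1 = \<phi> 1 x"
proof -
  obtain \<tau>\<^sub>1 \<tau>\<^sub>2 where "\<And>x y. \<phi> x y = \<tau>\<^sub>1 (x * y) + \<tau>\<^sub>2 (y * x)"
    using assms unfolding two_sided_zero_product_determined_def by blast
  then show ?thesis by simp
qed

text \<open>Allows the exchange of \<open>x\<close> and \<open>1\<close> to be applied to the
  functional twisted by \<open>z\<close>.\<close>

lemma (in unital_algebra) bilinear_functional_mult_right:
  assumes "bilinear_functional scale \<phi>"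
  shows "bilinear_functional scale (\<lambda>x y. \<phi> x (y * z))"
proof -
  have "Vector_Spaces.linear scale scale (\<lambda>y. y * z)"
    by unfold_locales (simp_all add: distrib_right scale_mult_left)
  then have "linear_functional scale (\<lambda>y. \<phi> x (y * z))" for x
    using Vector_Spaces.linear_compose[of scale scale "\<lambda>y. y * z" "(*)" "\<phi> x"] assms
    by (simp add: bilinear_functional_def o_def)
  then show ?thesis
    using assms by (simp add: bilinear_functional_def)
qed

lemma (in unital_algebra) two_sided_zpd_imp_zpd:
  assumes "two_sided_zero_product_determined scale"
  shows "zero_product_determined scale"
  unfolding zero_product_determined_def
proof (intro allI impI, elim conjE)
  fix \<phi>
  assume bil: "bilinear_functional scale \<phi>" and zero: "\<forall>x y. x * y = 0 \<longrightarrow> \<phi> x y = 0"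
  \<comment> \<open>Associativity: \<open>x * (y * z) = (x * y) * z = 0\<close>.\<close>
  have "\<phi> x (y * z) = 0" if "x * y = 0" for x y z
    using zero that by (simp flip: mult.assoc)
  then have "\<phi> x z = \<phi> 1 (x * z)" for x z
    using two_sided_zpd_exchange_unit[OF assms bilinear_functional_mult_right[OF bil, of z], of x]
    by simp
  \<comment> \<open>The witness is \<open>\<phi> 1\<close>, linear by bilinearity of
    \<open>\<phi>\<close>.\<close>
  then show "\<exists>\<tau>. linear_functional scale \<tau> \<and> (\<forall>x y. \<phi> x y = \<tau> (x * y))"
    using bil unfolding bilinear_functional_def by blast
qed

lemma (in unital_algebra) two_sided_zpd_imp_zLpd:
  assumes "two_sided_zero_product_determined scale"
  shows "zero_lie_product_determined scale"
  unfolding zero_lie_product_determined_def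
proof (intro allI impI, elim conjE)
  fix \<phi>
  assume bil: "bilinear_functional scale \<phi>"
    and zero: "\<forall>x y. lie_bracket x y = 0 \<longrightarrow> \<phi> x y = 0"
  \<comment> \<open>If \<open>x * y\<close> and \<open>y * x\<close> both vanish, then
    \<open>x\<close> and \<open>y\<close> commute, so \<open>\<phi> x y = 0\<close>.\<close>
  then obtain \<tau>\<^sub>1 \<tau>\<^sub>2 where lin: "linear_functional scale \<tau>\<^sub>1"
    and eq: "\<And>x y. \<phi> x y = \<tau>\<^sub>1 (x * y) + \<tau>\<^sub>2 (y * x)"
    using assms unfolding two_sided_zero_product_determined_def lie_bracket_def
    by (metis diff_self)
  have "\<tau>\<^sub>1 a + \<tau>\<^sub>2 a = 0" for a
    using zero eq[of a 1] by (simp add: lie_bracket_def)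
  then have "\<tau>\<^sub>2 a = - \<tau>\<^sub>1 a" for a
    by (simp add: eq_neg_iff_add_eq_0 add.commute)
  \<comment> \<open>Now \<open>\<phi> x y\<close> is
    \<open>\<tau>\<^sub>1 (x * y) - \<tau>\<^sub>1 (y * x)\<close>, and linearity merges the two
    terms.\<close>
  then have "\<phi> x y = \<tau>\<^sub>1 (lie_bracket x y)" for x y
    using module_hom.diff[OF lin[unfolded linear_iff_module_hom]] by (simp add: eq lie_bracket_def)
  then show "\<exists>\<tau>. linear_functional scale \<tau> \<and> (\<forall>x y. \<phi> x y = \<tau> (lie_bracket x y))"
    using lin by blast
qed

theorem proposition2p1:
  fixes scale :: "'f::field \<Rightarrow> 'a::{ring, monoid_mult} \<Rightarrow> 'a"
  assumes "unital_algebra scale"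
    and "two_sided_zero_product_determined scale"
  shows "zero_product_determined scale \<and> zero_lie_product_determined scale"
  using assms unital_algebra.two_sided_zpd_imp_zpd unital_algebra.two_sided_zpd_imp_zLpd by blast

end
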